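(* Let $G^L$ be a metric on $\operatorname{Imm}(S^1,\mathbb R^2)$ given by an inertia operator $L$ satisfying the standing assumptions listed in the context. Let $c\in \operatorname{Imm}(S^1,\mathbb R^2)$ and let $H(c)$ be any complement of $\operatorname{Tan}(c)$ in $T_c\operatorname{Imm}(S^1,\mathbb R^2)$, i.e. $H(c)$ is a linear subspace with $$T_c\operatorname{Imm}(S^1,\mathbb R^2)=\operatorname{Tan}(c)\oplus H(c),$$ and let $P^{\operatorname{tan}}$ and $P^{H}$ be the corresponding projections onto $\operatorname{Tan}(c)$ and $H(c)$. Then the following conditions are equivalent: (a) The tangent space splits into the vertical and the horizontal space, $T_c\operatorname{Imm}(S^1,\mathbb R^2)=\operatorname{Ver}_c\oplus\operatorname{Hor}_c$, and this splitting coincides with the splitting $\operatorname{Tan}(c)\oplus H(c)$ (that is, $\operatorname{Hor}_c=H(c)$). (b) The inertia operator $L_c$ admits a decomposition $$L_c=(P^{\operatorname{tan}})^*\circ\tilde L_c\circ P^{\operatorname{tan}}+(P^{H})^*\circ\tilde L_c\circ P^{H},$$ where $\tilde L_c:T_c\operatorname{Imm}(S^1,\mathbb R^2)\to T_c\operatorname{Imm}(S^1,\mathbb R^2)$ is an invertible pseudo-differential operator and ${}^*$ denotes the adjoint with respect to the reparametrization-invariant $L^2$-metric at $c$.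
   Context: $\operatorname{Imm}(S^1,\mathbb R^2)$ is the space of regular planar curves, i.e. smooth maps $c:S^1\to\mathbb R^2$ with $c'(\theta)\neq 0$ for all $\theta$; it is open in $C^\infty(S^1,\mathbb R^2)$, so $T_c\operatorname{Imm}(S^1,\mathbb R^2)=C^\infty(S^1,\mathbb R^2)$. $\operatorname{Diff}(S^1)$ is the group of smooth diffeomorphisms of $S^1$, acting on $\operatorname{Imm}(S^1,\mathbb R^2)$ by $(c,\varphi)\mapsto c\circ\varphi$. For a curve $c$, write $ds=|c'|\,d\theta$ (arc-length integration), $v=c'/|c'|$ (unit tangent field) and $n=iv$ (unit normal field, $i$ being rotation by $\pi/2$). The reparametrization-invariant $L^2$-metric at $c$ is $\langle h,k\rangle_{L^2(ds)}=\int_{S^1}\langle h,k\rangle\,ds$. Standing assumptions on $L$: $L$ is a smooth bundle automorphism of $T\operatorname{Imm}(S^1,\mathbb R^2)$ such that at every $c$ the operator $L_c:T_c\operatorname{Imm}(S^1,\mathbb R^2)\to T_c\operatorname{Imm}(S^1,\mathbb R^2)$ is a pseudo-differential operator of order $2l$ which is symmetric and positive with respect to the $L^2$-metric at $c$. Moreover, $L$ is $\operatorname{Diff}(S^1)$-invariant: $L_{c\circ\varphi}(h\circ\varphi)=L_c(h)\circ\varphi$ for all $\varphi\in\operatorname{Diff}(S^1)$. The metric induced by $L$ is $$G^L_c(h,k)=\int_{S^1}\langle L_ch,k\rangle\,ds.$$ Tangential and normal fields: $\operatorname{Tan}(c)=\operatorname{Tan}_c=\{f\,v: f\in C^\infty(S^1)\}$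 and $\operatorname{Nor}(c)=\operatorname{Nor}_c=\{a\,n:a\in C^\infty(S^1)\}$, with $f,a$ real-valued. The vertical space at $c$ (the kernel of the differential of the projection $\operatorname{Imm}(S^1,\mathbb R^2)\to\operatorname{Imm}(S^1,\mathbb R^2)/\operatorname{Diff}(S^1)$) is $\operatorname{Ver}_c=\operatorname{Tan}_c$, and the horizontal space is its $G^L$-orthogonal complement $$\operatorname{Hor}_c=(\operatorname{Ver}_c)^{\perp,G^L}=\{h\in T_c\operatorname{Imm}(S^1,\mathbb R^2):L_ch\in\operatorname{Nor}_c\}.$$ In general $\operatorname{Ver}_c\oplus\operatorname{Hor}_c$ need not be all of $T_c\operatorname{Imm}(S^1,\mathbb R^2)$. Adjoint: for a projection $P$ on $T_c\operatorname{Imm}(S^1,\mathbb R^2)$, $P^*$ is characterized by $\int_{S^1}\langle P^*u,k\rangle ds=\int_{S^1}\langle u,Pk\rangle ds$ for all $k\in T_c\operatorname{Imm}(S^1,\mathbb R^2)$. In general $P^*u$ is the linear functional $k\mapsto\int_{S^1}\langle u,Pk\rangle ds$, where a field $w$ is identified with the functional $k\mapsto\int_{S^1}\langle w,k\rangle ds$; operator identities involving $P^*$ are understood under this identification. *)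

theory Defs
  imports "HOL-Analysis.Analysis"
begin

section \<open>Smooth functions on the circle\<close>

definition smooth :: "(real \<Rightarrow> 'a::real_normed_vector) \<Rightarrow> bool" where
  "smooth f \<longleftrightarrow>
     (\<exists>F. F 0 = f \<and> (\<forall>n x. (F n has_vector_derivative F (Suc n) x) (at x)))"

lemma smooth_const: "smooth (\<lambda>x. a)"
  unfolding smooth_def by (rule exI[of _ "\<lambda>n x. if n = 0 then a else 0"]) auto

lemma smooth_add: assumes "smooth f" "smooth g" shows "smooth (\<lambda>x. f x + g x)"
proof -
  obtain F G where F: "F 0 = f" "\<And>n x. (F n has_vector_derivative F (Suc n) x) (at x)"
    and G: "G 0 = g" "\<And>n x. (G n has_vector_derivative G (Suc n) x) (at x)"
    using assms unfolding smooth_def by metis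
  show ?thesis
    unfolding smooth_def
    by (rule exI[of _ "\<lambda>n x. F n x + G n x"]) (use F G in \<open>auto intro: has_vector_derivative_add\<close>)
qed

lemma smooth_scaleR: assumes "smooth f" shows "smooth (\<lambda>x. r *\<^sub>R f x)"
proof -
  obtain F where F: "F 0 = f" "\<And>n x. (F n has_vector_derivative F (Suc n) x) (at x)"
    using assms unfolding smooth_def by metis
  show ?thesis
    unfolding smooth_def
    by (rule exI[of _ "\<lambda>n x. r *\<^sub>R F n x"])
       (use F in \<open>auto intro!: bounded_linear.has_vector_derivative[OF bounded_linear_scaleR_right]\<close>)
qed

text \<open>The space of smooth maps from the circle to a normed space, the circle being the real line
  modulo \<open>2 * pi\<close>: smooth functions of the angle that are \<open>2 * pi\<close>-periodic.\<close>

typedef (overloaded) ('a::real_normed_vector) cinf =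
  "{h :: real \<Rightarrow> 'a. smooth h \<and> (\<forall>\<theta>. h (\<theta> + 2 * pi) = h \<theta>)}"
  morphisms ev Cinf
  by (rule exI[of _ "\<lambda>x. 0"]) (simp add: smooth_const)

instantiation cinf :: (real_normed_vector) real_vector
begin

definition "0 = Cinf (\<lambda>\<theta>. 0)"
definition "h + k = Cinf (\<lambda>\<theta>. ev h \<theta> + ev k \<theta>)"
definition "r *\<^sub>R h = Cinf (\<lambda>\<theta>. r *\<^sub>R ev h \<theta>)"
definition "- h = (-1) *\<^sub>R (h :: 'a cinf)"
definition "h - k = h + - (k :: 'a cinf)"

lemma ev_zero [simp]: "ev 0 = (\<lambda>\<theta>. 0)"
  unfolding zero_cinf_def by (subst Cinf_inverse) (auto simp: smooth_const)

lemma ev_add [simp]: "ev (h + k) = (\<lambda>\<theta>. ev h \<theta> + ev k \<theta>)"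
  unfolding plus_cinf_def using ev[of h] ev[of k] by (subst Cinf_inverse) (auto simp: smooth_add)

lemma ev_scaleR [simp]: "ev (r *\<^sub>R h) = (\<lambda>\<theta>. r *\<^sub>R ev h \<theta>)"
  unfolding scaleR_cinf_def using ev[of h] by (subst Cinf_inverse) (auto simp: smooth_scaleR)

lemma ev_uminus [simp]: "ev (- h) = (\<lambda>\<theta>. - ev h \<theta>)"
  unfolding uminus_cinf_def by simp

lemma ev_diff [simp]: "ev (h - k) = (\<lambda>\<theta>. ev h \<theta> - ev k \<theta>)"
  unfolding minus_cinf_def by simp

instance
  by standard (auto simp: ev_inject[symmetric] algebra_simps)

end

definition higher_deriv :: "nat \<Rightarrow> 'a::real_normed_vector cinf \<Rightarrow> real \<Rightarrow> 'a" where
  "higher_deriv n h = ((\<lambda>g \<theta>. vector_derivative g (at \<theta>)) ^^ n) (ev h)"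

text \<open>Convergence in the Frechet topology: uniform convergence of every derivative.\<close>

definition cinf_tendsto :: "('b \<Rightarrow> 'a::real_normed_vector cinf) \<Rightarrow> 'a cinf \<Rightarrow> 'b filter \<Rightarrow> bool" where
  "cinf_tendsto X h F \<longleftrightarrow>
     (\<forall>n. uniform_limit UNIV (\<lambda>s. higher_deriv n (X s)) (higher_deriv n h) F)"

definition smooth_curve :: "(real \<Rightarrow> 'a::real_normed_vector cinf) \<Rightarrow> bool" where
  "smooth_curve \<gamma> \<longleftrightarrow>
     (\<exists>\<Gamma>. \<Gamma> 0 = \<gamma> \<and>
        (\<forall>n t. cinf_tendsto (\<lambda>s. (\<Gamma> n s - \<Gamma> n t) /\<^sub>R (s - t)) (\<Gamma> (Suc n) t) (at t)))"

section \<open>Regular curves\<close>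

type_synonym field = "(real^2) cinf"

definition Imm :: "field set" where
  "Imm = {c. \<forall>\<theta>. higher_deriv 1 c \<theta> \<noteq> 0}"

text \<open>Diffeomorphisms of the circle are represented by their lifts to the real line; the two signs
  are the orientation preserving and the orientation reversing ones.\<close>

definition Diff_S1 :: "(real \<Rightarrow> real) set" where
  "Diff_S1 = {\<phi>. bij \<phi> \<and> smooth \<phi> \<and> smooth (inv \<phi>) \<and>
     ((\<forall>\<theta>. \<phi> (\<theta> + 2 * pi) = \<phi> \<theta> + 2 * pi) \<or> (\<forall>\<theta>. \<phi> (\<theta> + 2 * pi) = \<phi> \<theta> - 2 * pi))}"

definition unit_tangent :: "field \<Rightarrow> real \<Rightarrow> real^2" where
  "unit_tangent c \<theta> = higher_deriv 1 c \<theta> /\<^sub>R norm (higher_deriv 1 c \<theta>)"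

definition L2 :: "field \<Rightarrow> field \<Rightarrow> field \<Rightarrow> real" where
  "L2 c h k = integral {0..2 * pi} (\<lambda>\<theta>. (ev h \<theta> \<bullet> ev k \<theta>) * norm (higher_deriv 1 c \<theta>))"

section \<open>Pseudo-differential operators on the circle\<close>

type_synonym symb = "real \<Rightarrow> real \<Rightarrow> complex^2^2"

text \<open>Hoermander's class \<open>S^m\<close> of matrix-valued symbols \<open>p x \<xi>\<close>; the smooth function
  \<open>P a b\<close> is the derivative of \<open>p\<close> of order \<open>a\<close> in \<open>x\<close> and \<open>b\<close> in \<open>\<xi>\<close>.\<close>

definition symbol_class :: "real \<Rightarrow> symb set" where
  "symbol_class m = {p. \<exists>P :: nat \<Rightarrow> nat \<Rightarrow> symb. P 0 0 = p \<and>
     (\<forall>a b. continuous_on UNIV (\<lambda>(x, \<xi>). P a b x \<xi>) \<and>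
        (\<forall>x \<xi>. ((\<lambda>y. P a b y \<xi>) has_vector_derivative P (Suc a) b x \<xi>) (at x) \<and>
               (P a b x has_vector_derivative P a (Suc b) x \<xi>) (at \<xi>)) \<and>
        (\<exists>C. \<forall>x \<xi>. norm (P a b x \<xi>) \<le> C * (1 + \<bar>\<xi>\<bar>) powr (m - real b)))}"

definition complexify :: "real^2 \<Rightarrow> complex^2" where
  "complexify v = (\<chi> i. complex_of_real (v $ i))"

definition fourier :: "(real \<Rightarrow> real^2) \<Rightarrow> real \<Rightarrow> complex^2" where
  "fourier u \<xi> = (LINT x|lborel. cis (- (x * \<xi>)) *s complexify (u x))"

definition Op :: "symb \<Rightarrow> (real \<Rightarrow> real^2) \<Rightarrow> real \<Rightarrow> complex^2" where
  "Op p u x = (1 / (2 * pi)) *\<^sub>R (LINT \<xi>|lborel. cis (x * \<xi>) *s (p x \<xi> *v fourier u \<xi>))"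

definition test_function :: "real set \<Rightarrow> (real \<Rightarrow> 'a::real_normed_vector) \<Rightarrow> bool" where
  "test_function S u \<longleftrightarrow> smooth u \<and> (\<exists>K. compact K \<and> K \<subseteq> S \<and> (\<forall>x. x \<notin> K \<longrightarrow> u x = 0))"

text \<open>Operators of order \<open>m\<close> in Hoermander's sense: a continuous linear operator \<open>A\<close> such that in
  every local chart and for all cut-off functions \<open>\<phi>\<close> and \<open>\<psi>\<close> supported in it, the operator
  \<open>u \<mapsto> \<phi> A (\<psi> u)\<close> is given by a symbol in \<open>S^m\<close>. The charts are the circle minus a point, with
  the angle in \<open>{a<..<a + 2 * pi}\<close> as coordinate. Any two points lie in a common such chart, so the
  off-diagonal behaviour of the kernel is covered as well. The field \<open>h\<close> is \<open>\<psi> u\<close>, extended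
  by zero from the chart to the circle.\<close>

definition pseudo_differential :: "real \<Rightarrow> (field \<Rightarrow> field) \<Rightarrow> bool" where
  "pseudo_differential m A \<longleftrightarrow>
     linear A \<and>
     (\<forall>X h. cinf_tendsto X h sequentially \<longrightarrow> cinf_tendsto (\<lambda>n. A (X n)) (A h) sequentially) \<and>
     (\<forall>a (\<phi> :: real \<Rightarrow> real) (\<psi> :: real \<Rightarrow> real).
        test_function {a<..<a + 2 * pi} \<phi> \<and> test_function {a<..<a + 2 * pi} \<psi> \<longrightarrow>
        (\<exists>p \<in> symbol_class m. \<forall>u h. test_function UNIV u \<and>
           (\<forall>x \<in> {a..<a + 2 * pi}. ev h x = \<psi> x *\<^sub>R u x) \<longrightarrow>
           (\<forall>x. complexify (\<phi> x *\<^sub>R ev (A h) x) = Op p u x)))"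

section \<open>Inertia operators\<close>

text \<open>Smoothness of a fibre preserving map of the tangent bundle \<open>Imm \<times> field\<close>, in the sense of
  convenient calculus: smooth curves are mapped to smooth curves.\<close>

definition smooth_bundle_map :: "(field \<Rightarrow> field \<Rightarrow> field) \<Rightarrow> bool" where
  "smooth_bundle_map L \<longleftrightarrow>
     (\<forall>\<gamma> \<eta>. smooth_curve \<gamma> \<and> range \<gamma> \<subseteq> Imm \<and> smooth_curve \<eta> \<longrightarrow>
        smooth_curve (\<lambda>t. L (\<gamma> t) (\<eta> t)))"

definition bundle_automorphism :: "(field \<Rightarrow> field \<Rightarrow> field) \<Rightarrow> bool" where
  "bundle_automorphism L \<longleftrightarrow>
     (\<forall>c \<in> Imm. linear (L c) \<and> bij (L c)) \<and>
     smooth_bundle_map L \<and> smooth_bundle_map (\<lambda>c. inv (L c))"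

definition Diff_invariant :: "(field \<Rightarrow> field \<Rightarrow> field) \<Rightarrow> bool" where
  "Diff_invariant L \<longleftrightarrow>
     (\<forall>c \<in> Imm. \<forall>h. \<forall>\<phi> \<in> Diff_S1. \<forall>c' h'. ev c' = ev c \<circ> \<phi> \<and> ev h' = ev h \<circ> \<phi> \<longrightarrow>
        ev (L c' h') = ev (L c h) \<circ> \<phi>)"

definition inertia_operator :: "real \<Rightarrow> (field \<Rightarrow> field \<Rightarrow> field) \<Rightarrow> bool" where
  "inertia_operator l L \<longleftrightarrow>
     bundle_automorphism L \<and> Diff_invariant L \<and>
     (\<forall>c \<in> Imm. pseudo_differential (2 * l) (L c) \<and>
        (\<forall>h k. L2 c (L c h) k = L2 c h (L c k)) \<and>
        (\<forall>h. h \<noteq> 0 \<longrightarrow> L2 c (L c h) h > 0))"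

definition metric :: "(field \<Rightarrow> field \<Rightarrow> field) \<Rightarrow> field \<Rightarrow> field \<Rightarrow> field \<Rightarrow> real" where
  "metric L c h k = L2 c (L c h) k"

section \<open>Splittings of the tangent space\<close>

definition Tan :: "field \<Rightarrow> field set" where
  "Tan c = {h. \<exists>f :: real cinf. \<forall>\<theta>. ev h \<theta> = ev f \<theta> *\<^sub>R unit_tangent c \<theta>}"

definition Ver :: "field \<Rightarrow> field set" where
  "Ver c = Tan c"

definition Hor :: "(field \<Rightarrow> field \<Rightarrow> field) \<Rightarrow> field \<Rightarrow> field set" where
  "Hor L c = {h. \<forall>k \<in> Ver c. metric L c h k = 0}"

definition splits :: "'v::real_vector set \<Rightarrow> 'v set \<Rightarrow> bool" where
  "splits U W \<longleftrightarrow> subspace U \<and> subspace W \<and> U \<inter> W = {0} \<and> {u + w |u w. u \<in> U \<and> w \<in> W} = UNIV"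

text \<open>The projection onto \<open>U\<close> along \<open>W\<close>.\<close>

definition proj :: "'v::real_vector set \<Rightarrow> 'v set \<Rightarrow> 'v \<Rightarrow> 'v" where
  "proj U W h = (THE u. u \<in> U \<and> h - u \<in> W)"

text \<open>Under the identification of a field \<open>w\<close> with the functional \<open>L2 c w\<close>, the adjoint of a
  projection \<open>P\<close> takes values in the linear functionals.\<close>

definition adjoint_L2 :: "field \<Rightarrow> (field \<Rightarrow> field) \<Rightarrow> field \<Rightarrow> field \<Rightarrow> real" where
  "adjoint_L2 c P u = (\<lambda>k. L2 c u (P k))"

end

theory Submission
  imports Defs
begin

text \<open>Both conditions say that \<open>Tan c\<close> and \<open>H\<close> are orthogonal for \<open>G = metric L c\<close>.

  Write fields as \<open>h = P_tan h + P_H h\<close> and expand \<open>G h k\<close> into four terms. If \<open>H\<close> is the horizontal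
  space, the two mixed terms vanish (one by definition, the other by symmetry of \<open>G\<close>), and what
  remains is the decomposition in (b) with \<open>L c\<close> itself as the operator in the middle, an
  invertible pseudo-differential operator by the assumptions on \<open>L\<close>.

  Conversely, the decomposition in (b) contains no mixed terms, so it makes \<open>G h k\<close> vanish for
  \<open>h \<in> H\<close> and \<open>k \<in> Tan c\<close>; hence \<open>H \<subseteq> Hor L c\<close>. Equality is then forced by
  positivity of \<open>G\<close>: the tangential part of a horizontal field is again horizontal, so it is
  orthogonal to itself (\<open>orthogonal_complement_eq\<close>).

  The only analysis involved is that \<open>L2 c\<close> is bilinear, which needs integrability, that is,
  continuity of fields and of the first derivative of the curve.\<close>

lemma splits_commute:
  assumes "splits U W"
  shows "splits W U"
proof -
  have "{w + u |w u. w \<in> W \<and> u \<in> U} = {u + w |u w. u \<in> U \<and> w \<in> W}"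
    using add.commute by blast
  with assms show ?thesis
    unfolding splits_def by (simp add: Int_commute)
qed

lemma splitsE:
  assumes "splits U W"
  obtains u w where "u \<in> U" "w \<in> W" "h = u + w"
proof -
  have "h \<in> {u + w |u w. u \<in> U \<and> w \<in> W}"
    using assms unfolding splits_def by auto
  then show ?thesis
    using that by auto
qed

lemma proj_add:
  assumes "splits U W" "u \<in> U" "w \<in> W"
  shows "proj U W (u + w) = u"
  unfolding proj_def
proof (rule the_equality)
  show "u \<in> U \<and> u + w - u \<in> W"
    using assms by simp
next
  fix u' assume u': "u' \<in> U \<and> u + w - u' \<in> W"
  have U: "subspace U" and W: "subspace W" and UW: "U \<inter> W = {0}"
    using assms(1) by (auto simp: splits_def)
  have "u - u' \<in> U"
    using U u' assms(2) by (simp add: subspace_diff)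
  moreover have "u - u' \<in> W"
    using subspace_diff[OF W, of "u + w - u'" w] u' assms(3) by simp
  ultimately have "u - u' = 0"
    using UW by blast
  then show "u' = u"
    by simp
qed

lemma proj_add_complement:
  assumes "splits U W" "u \<in> U" "w \<in> W"
  shows "proj W U (u + w) = w"
  using proj_add[OF splits_commute[OF assms(1)] assms(3,2)] by (simp add: add.commute)

text \<open>The \<open>U\<close>-component of a vector orthogonal to \<open>U\<close> is orthogonal to itself, hence zero by
  positivity. So a complement that is orthogonal to \<open>U\<close> cannot be smaller than the full orthogonal
  space.\<close>

lemma orthogonal_complement_eq:
  fixes G :: "'v::real_vector \<Rightarrow> 'v \<Rightarrow> real"
  assumes "splits U W"
    and add: "\<And>x y z. G (x + y) z = G x z + G y z"
    and pos: "\<And>u. u \<in> U \<Longrightarrow> u \<noteq> 0 \<Longrightarrow> G u u > 0"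
    and orth: "\<And>w u. w \<in> W \<Longrightarrow> u \<in> U \<Longrightarrow> G w u = 0"
  shows "{h. \<forall>u \<in> U. G h u = 0} = W"
proof (intro equalityI subsetI)
  fix h assume h: "h \<in> {h. \<forall>u \<in> U. G h u = 0}"
  obtain u w where uw: "u \<in> U" "w \<in> W" "h = u + w"
    using splitsE[OF assms(1)] .
  have "G u u = 0"
    using h uw add[of u w u] orth[of w u] by simp
  then have "u = 0"
    using pos[of u] uw(1) by force
  then show "h \<in> W"
    using uw by simp
qed (use orth in auto)

lemma smooth_imp_continuous_on:
  assumes "smooth f"
  shows "continuous_on A f"
proof -
  obtain F where F: "F 0 = f" "\<And>n x. (F n has_vector_derivative F (Suc n) x) (at x)"
    using assms unfolding smooth_def by metis
  show ?thesis
    using F by (metis continuous_at_imp_continuous_on has_vector_derivative_continuous)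
qed

lemma smooth_vector_derivative:
  assumes "smooth f"
  shows "smooth (\<lambda>x. vector_derivative f (at x))"
proof -
  obtain F where F: "F 0 = f" "\<And>n x. (F n has_vector_derivative F (Suc n) x) (at x)"
    using assms unfolding smooth_def by metis
  have "F (Suc 0) = (\<lambda>x. vector_derivative f (at x))"
    using vector_derivative_at[OF F(2)[of 0]] unfolding F(1) by (simp add: fun_eq_iff)
  then show ?thesis
    unfolding smooth_def using F by (intro exI[of _ "\<lambda>n. F (Suc n)"]) simp
qed

lemma smooth_higher_deriv: "smooth (higher_deriv n h)"
proof (induction n)
  case 0
  then show ?case
    using ev[of h] by (simp add: higher_deriv_def)
next
  case (Suc n)
  then show ?case
    using smooth_vector_derivative by (simp add: higher_deriv_def)
qed

lemma L2_integrable: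
  fixes h k c :: field
  shows "(\<lambda>\<theta>. (ev h \<theta> \<bullet> ev k \<theta>) * norm (higher_deriv 1 c \<theta>)) integrable_on {0..2 * pi}"
proof -
  have ev_continuous: "continuous_on {0..2 * pi} (ev f)" for f :: field
    using ev[of f] by (simp add: smooth_imp_continuous_on)
  show ?thesis
    by (intro integrable_continuous_interval continuous_on_mult continuous_on_inner
          continuous_on_norm ev_continuous smooth_imp_continuous_on[OF smooth_higher_deriv])
qed

lemma L2_commute: "L2 c h k = L2 c k h"
  by (simp add: L2_def inner_commute)

lemma L2_add_left: "L2 c (h + h') k = L2 c h k + L2 c h' k"
  unfolding L2_def ev_add inner_add_left distrib_right
  by (rule integral_add[OF L2_integrable L2_integrable])

lemma L2_add_right: "L2 c h (k + k') = L2 c h k + L2 c h k'"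
  using L2_add_left[of c k k' h] by (simp only: L2_commute[of c h])

lemma L2_zero_left [simp]: "L2 c 0 k = 0"
  by (simp add: L2_def)

lemma L2_zero_right [simp]: "L2 c h 0 = 0"
  by (simp add: L2_def)

theorem theorem1:
  fixes L :: "field \<Rightarrow> field \<Rightarrow> field" and l :: real and c :: field and H :: "field set"
    and P_tan P_H :: "field \<Rightarrow> field"
  assumes "inertia_operator l L"
    and "c \<in> Imm"
    and "splits (Tan c) H"
    and "P_tan = proj (Tan c) H"
    and "P_H = proj H (Tan c)"
  shows "splits (Ver c) (Hor L c) \<and> Hor L c = H \<longleftrightarrow>
    (\<exists>(L' :: field \<Rightarrow> field) m. pseudo_differential m L' \<and> bij L' \<and>
       (\<forall>h k. L2 c (L c h) k =
          adjoint_L2 c P_tan (L' (P_tan h)) k + adjoint_L2 c P_H (L' (P_H h)) k))"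
    (is "?a \<longleftrightarrow> ?b")
proof -
  have lin: "linear (L c)" and bij: "bij (L c)"
    and pd: "pseudo_differential (2 * l) (L c)"
    and sym: "\<And>h k. L2 c (L c h) k = L2 c h (L c k)"
    and pos: "\<And>h. h \<noteq> 0 \<Longrightarrow> L2 c (L c h) h > 0"
    using assms(1,2) by (auto simp: inertia_operator_def bundle_automorphism_def)
  have P [simp]: "P_tan (t + w) = t" "P_H (t + w) = w" if "t \<in> Tan c" "w \<in> H" for t w
    using proj_add[OF assms(3) that] proj_add_complement[OF assms(3) that] assms(4,5) by auto
  have zero: "0 \<in> Tan c" "0 \<in> H"
    using assms(3) by (auto simp: splits_def subspace_0)
  show ?thesis
  proof
    assume a: ?a
    have orth: "L2 c (L c w) t = 0" "L2 c (L c t) w = 0" if "w \<in> H" "t \<in> Tan c" for w t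
    proof -
      show "L2 c (L c w) t = 0"
        using a that by (auto simp: Hor_def Ver_def metric_def)
      then show "L2 c (L c t) w = 0"
        using sym[of t w] L2_commute[of c t] by simp
    qed
    have "L2 c (L c h) k =
        adjoint_L2 c P_tan (L c (P_tan h)) k + adjoint_L2 c P_H (L c (P_H h)) k" for h k
    proof -
      obtain t w where h: "t \<in> Tan c" "w \<in> H" "h = t + w"
        using splitsE[OF assms(3)] .
      obtain t' w' where k: "t' \<in> Tan c" "w' \<in> H" "k = t' + w'"
        using splitsE[OF assms(3)] .
      show ?thesis
        using h k orth
        by (simp add: adjoint_L2_def linear_add[OF lin] L2_add_left L2_add_right)
    qed
    with pd bij show ?b
      by blast
  next
    assume ?b
    then obtain L' m where L': "pseudo_differential m L'"
      and dec: "\<And>h k. L2 c (L c h) k =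
          adjoint_L2 c P_tan (L' (P_tan h)) k + adjoint_L2 c P_H (L' (P_H h)) k"
      by blast
    have L'0: "L' 0 = 0"
      using L' by (simp add: pseudo_differential_def linear_0)
    \<comment> \<open>Only \<open>L' (P_tan w) = L' 0\<close> and \<open>P_H t = 0\<close> occur, so each of the two terms has a zero factor.\<close>
    have orth: "metric L c w t = 0" if "w \<in> H" "t \<in> Tan c" for w t
      using dec[of w t] P[OF zero(1) that(1)] P[OF that(2) zero(2)] L'0
      by (simp add: metric_def adjoint_L2_def)
    have "Hor L c = H"
      unfolding Hor_def Ver_def
      by (rule orthogonal_complement_eq[OF assms(3)])
         (use orth pos in \<open>auto simp: metric_def linear_add[OF lin] L2_add_left\<close>)
    with assms(3) show ?a
      by (simp add: Ver_def)
  qed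
qed

end
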